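(* Let $Q$ be a Jordan loop and $c\in Q$. Then $c^n$ is well-defined whenever $1\le n\le 5$.
   Context: A loop is a quasigroup (a magma in which $ax=b$ and $ya=b$ have unique solutions for all $a,b$) with a neutral element. A loop is Jordan if it is commutative and satisfies $x^2(yx)=(x^2y)x$. For $n>0$, $c^n$ is well-defined if the value of the product $c\cdots c$ of $n$ factors $c$ does not depend on how the factors are parenthesized. *)

theory Defs
  imports "HOL-Algebra.Group"
begin

locale magma =
  fixes Q (structure)
  assumes m_closed [intro, simp]:
    "\<lbrakk>x \<in> carrier Q; y \<in> carrier Q\<rbrakk> \<Longrightarrow> x \<otimes> y \<in> carrier Q"

(* The field "one" of the record Q is unconstrained here; it becomes relevant in "loop". *)
locale quasigroup = magma +
  assumes left_div:
    "\<lbrakk>a \<in> carrier Q; b \<in> carrier Q\<rbrakk> \<Longrightarrow> \<exists>!x. x \<in> carrier Q \<and> a \<otimes> x = b"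
  and right_div:
    "\<lbrakk>a \<in> carrier Q; b \<in> carrier Q\<rbrakk> \<Longrightarrow> \<exists>!y. y \<in> carrier Q \<and> y \<otimes> a = b"

locale loop = quasigroup +
  assumes one_closed [intro, simp]: "\<one> \<in> carrier Q"
  and l_one [simp]: "x \<in> carrier Q \<Longrightarrow> \<one> \<otimes> x = x"
  and r_one [simp]: "x \<in> carrier Q \<Longrightarrow> x \<otimes> \<one> = x"

locale jordan_loop = loop +
  assumes m_comm: "\<lbrakk>x \<in> carrier Q; y \<in> carrier Q\<rbrakk> \<Longrightarrow> x \<otimes> y = y \<otimes> x"
  and jordan: "\<lbrakk>x \<in> carrier Q; y \<in> carrier Q\<rbrakk>
    \<Longrightarrow> (x \<otimes> x) \<otimes> (y \<otimes> x) = ((x \<otimes> x) \<otimes> y) \<otimes> x"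

(* Full parenthesizations of a product of n > 0 factors are the full binary trees with n leaves. *)
datatype parenthesization = Factor | Product parenthesization parenthesization

fun num_factors :: "parenthesization \<Rightarrow> nat" where
  "num_factors Factor = 1"
| "num_factors (Product s t) = num_factors s + num_factors t"

fun paren_power :: "('a, 'b) monoid_scheme \<Rightarrow> 'a \<Rightarrow> parenthesization \<Rightarrow> 'a" where
  "paren_power Q c Factor = c"
| "paren_power Q c (Product s t) = paren_power Q c s \<otimes>\<^bsub>Q\<^esub> paren_power Q c t"

(* Meaningful for n > 0 only: there is no parenthesization with 0 factors. *)
definition power_well_defined :: "('a, 'b) monoid_scheme \<Rightarrow> 'a \<Rightarrow> nat \<Rightarrow> bool" where
  "power_well_defined Q c n \<longleftrightarrow>
    (\<forall>s t. num_factors s = n \<longrightarrow> num_factors t = n \<longrightarrow> paren_power Q c s = paren_power Q c t)"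

end

theory Submission
  imports Defs
begin

text \<open>
  Up to commutativity, the only products of powers of total exponent at most 5 that are not
  multiplications by \<open>c\<close> or \<open>\<one>\<close> are \<open>c\<^sup>2c\<^sup>2\<close> and \<open>c\<^sup>3c\<^sup>2\<close>. They are the left-hand sides of the Jordan
  identity for \<open>x = c\<close> and \<open>y = c\<close>, \<open>y = c\<^sup>2\<close>, hence equal \<open>c\<^sup>3c\<close> and \<open>c\<^sup>4c\<close>.
\<close>

context jordan_loop
begin

lemma pow_Suc: "c [^] Suc n = c [^] n \<otimes> c"
  by (simp add: nat_pow_def)

lemma pow_closed:
  assumes "c \<in> carrier Q"
  shows "c [^] (n::nat) \<in> carrier Q"
  using assms by (induction n) (simp_all add: nat_pow_def)

lemma pow_mult_le_5:
  fixes i j :: nat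
  assumes c: "c \<in> carrier Q" and "i + j \<le> 5"
  shows "c [^] i \<otimes> c [^] j = c [^] (i + j)"
proof -
  have c0: "c [^] (0::nat) = \<one>" and c1: "c [^] (1::nat) = c" and c2: "c [^] (2::nat) = c \<otimes> c"
    using c by (simp_all add: nat_pow_def numeral_2_eq_2)
  have c3: "c [^] (3::nat) = (c \<otimes> c) \<otimes> c" and c4: "c [^] (4::nat) = c [^] (3::nat) \<otimes> c"
    and c5: "c [^] (5::nat) = c [^] (4::nat) \<otimes> c"
    using pow_Suc[of c 2] pow_Suc[of c 3] pow_Suc[of c 4] by (simp_all add: c2)
  have c22: "c [^] (2::nat) \<otimes> c [^] (2::nat) = c [^] (4::nat)"
    unfolding c2 c3 c4 using jordan[OF c c] .
  \<comment> \<open>Commutativity turns the left side into \<open>c^2 c^3\<close>; by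
    \<open>c22\<close>, the Jordan right side \<open>(c^2 c^2) c\<close> is
    \<open>c^4 c\<close>.\<close>
  have c32: "c [^] (3::nat) \<otimes> c [^] (2::nat) = c [^] (5::nat)"
    using jordan[OF c, of "c \<otimes> c"] c c22 m_comm[of "c \<otimes> c \<otimes> c" "c \<otimes> c"]
    by (simp add: c2 c3 c5)
  have ordered: "c [^] k \<otimes> c [^] l = c [^] (k + l)" if kl: "l \<le> k" "k + l \<le> 5" for k l :: nat
  proof -
    \<comment> \<open>The bounds force \<open>2 * l \<le> 5\<close>, so
      \<open>l \<le> 2\<close>.\<close>
    consider "l = 0" | "l = 1" | "k = 2" "l = 2" | "k = 3" "l = 2"
      using kl by arith
    then show ?thesis
    proof cases
      case 1
      then show ?thesis using pow_closed[OF c] by (simp add: c0)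
    next
      case 2
      then show ?thesis using c1 by (simp add: pow_Suc)
    qed (simp_all add: c22 c32)
  qed
  show ?thesis
    using ordered[of i j] ordered[of j i] assms(2) m_comm[OF pow_closed pow_closed, OF c c, of i j]
    by (cases "j \<le> i") (simp_all add: add.commute)
qed

text \<open>The left-nested power serves as common value of all parenthesizations. Both subtrees of
  a product inherit the bound 5, so the induction hypotheses and \<open>pow_mult_le_5\<close>
  apply.\<close>

lemma paren_power_eq_pow:
  assumes c: "c \<in> carrier Q" and "num_factors t \<le> 5"
  shows "paren_power Q c t = c [^] num_factors t"
  using assms(2)
proof (induction t)
  case Factor
  then show ?case using c by (simp add: nat_pow_def)
next
  case (Product s t)
  then show ?case using pow_mult_le_5[OF c] by simp
qed

end

theorem lemma5p2:
  fixes Q :: "('a, 'b) monoid_scheme" and c :: 'a and n :: nat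
  assumes "jordan_loop Q"
    and "c \<in> carrier Q"
    and "1 \<le> n" and "n \<le> 5"
  shows "power_well_defined Q c n"
  using jordan_loop.paren_power_eq_pow[OF assms(1,2)] assms(4)
  by (simp add: power_well_defined_def)

end
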